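(* Let $N\ge2$. For any vector $\boldsymbol{x}\in(\mathbb{R}\setminus\{0\})^N$, the maps $f_{\boldsymbol{x}}(M)=\mathrm{diag}(\boldsymbol{x})\,M$ and $g_{\boldsymbol{x}}(M)=M\,\mathrm{diag}(\boldsymbol{x})$ are permutations of $\mathcal{C}^N$; that is, each maps $\mathcal{C}^N$ bijectively onto itself.
   Context: The set $\mathcal{C}_L^N$ of L-CoLT (lower-collinear triangular) matrices consists of all $M=[m_{i,j}]\in\mathbb{R}^{N\times N}$ with $m_{i,j}=0$ for $i<j$ such that there is a vector $\boldsymbol{r}\in(\mathbb{R}\setminus\{0\})^{N-1}$ with $m_{i+1,j}/m_{i,j}=r_i$ for all $1\le j\le i\le N-1$ (in particular the denominators are nonzero). The set $\mathcal{C}_U^N$ of U-CoLT (upper-collinear triangular) matrices consists of all $M=[m_{i,j}]\in\mathbb{R}^{N\times N}$ with $m_{i,j}=0$ for $i\ge j$ such that there is a vector $\boldsymbol{r}'\in(\mathbb{R}\setminus\{0\})^{N-2}$ with $m_{i-1,j}/m_{i,j}=r'_{i-1}$ for all $2\le i<j\le N$ (in particular the denominators are nonzero). $\mathcal{C}^N=\mathcal{C}_L^N+\mathcal{C}_U^N=\{A+B : A\in\mathcal{C}_L^N,\ B\in\mathcal{C}_U^N\}$. $\mathrm{diag}(\boldsymbol{x})$ is the diagonal matrix with diagonal $\boldsymbol{x}$. *)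

theory Defs
  imports "Jordan_Normal_Form.Matrix"
begin

text \<open>Vector and matrix indices start at 0, so the entry $m_{i,j}$ of the usual 1-based
  notation is \<open>M $$ (i - 1, j - 1)\<close>. Since \<open>a / 0 = 0\<close> in HOL, the requirement that the ratios
  be defined is stated as a separate conjunct.\<close>

definition nonzero_vecs :: "nat \<Rightarrow> real vec set" where
  "nonzero_vecs n = {v \<in> carrier_vec n. \<forall>i<n. v $ i \<noteq> 0}"

definition L_CoLT :: "nat \<Rightarrow> real mat set" where
  "L_CoLT N = {M \<in> carrier_mat N N.
     (\<forall>i<N. \<forall>j<N. i < j \<longrightarrow> M $$ (i, j) = 0) \<and>
     (\<exists>r \<in> nonzero_vecs (N - 1). \<forall>i j. j \<le> i \<and> Suc i < N \<longrightarrow>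
        M $$ (i, j) \<noteq> 0 \<and> M $$ (Suc i, j) / M $$ (i, j) = r $ i)}"

text \<open>With 1-based row index $i \ge 2$, the variable \<open>k\<close> below is $i - 2$: the 0-based index of
  row $i - 1$, and also the 0-based position of $r'_{i-1}$ in $r'$.\<close>

definition U_CoLT :: "nat \<Rightarrow> real mat set" where
  "U_CoLT N = {M \<in> carrier_mat N N.
     (\<forall>i<N. \<forall>j<N. i \<ge> j \<longrightarrow> M $$ (i, j) = 0) \<and>
     (\<exists>r' \<in> nonzero_vecs (N - 2). \<forall>k j. Suc k < j \<and> j < N \<longrightarrow>
        M $$ (Suc k, j) \<noteq> 0 \<and> M $$ (k, j) / M $$ (Suc k, j) = r' $ k)}"

definition CoLT :: "nat \<Rightarrow> real mat set" where
  "CoLT N = {A + B | A B. A \<in> L_CoLT N \<and> B \<in> U_CoLT N}"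

definition diag_of_vec :: "real vec \<Rightarrow> real mat" where
  "diag_of_vec x = mat_diag (dim_vec x) (\<lambda>i. x $ i)"

end

theory Submission imports Defs begin

text \<open>Scaling row \<open>i\<close> by \<open>x\<^sub>i \<noteq> 0\<close> multiplies each ratio of consecutive rows by the nonzero
  constant \<open>x\<^sub>i\<^sub>+\<^sub>1 / x\<^sub>i\<close> (or its inverse), while scaling columns leaves these ratios unchanged.
  Hence both maps preserve each of the two triangular sets, and therefore their sum.
  The diagonal matrix of reciprocals provides the inverse maps.\<close>

lemma diag_mult_left:
  assumes "x \<in> carrier_vec N" "M \<in> carrier_mat N n"
  shows "diag_of_vec x * M = mat N n (\<lambda>(i, j). x $ i * M $$ (i, j))"
  using assms by (simp add: diag_of_vec_def mat_diag_mult_left)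

lemma diag_mult_right:
  assumes "x \<in> carrier_vec N" "M \<in> carrier_mat n N"
  shows "M * diag_of_vec x = mat n N (\<lambda>(i, j). M $$ (i, j) * x $ j)"
  using assms by (simp add: diag_of_vec_def mat_diag_mult_right)

lemma diag_of_vec_carrier:
  "x \<in> carrier_vec N \<Longrightarrow> diag_of_vec x \<in> carrier_mat N N"
  by (simp add: diag_of_vec_def)

text \<open>The ratio vector \<open>r\<close> appears as an explicit premise, so that each use names
  its witness and leaves only the shape, the zero pattern and the ratios to check.\<close>

lemma L_CoLT_I:
  assumes "M \<in> carrier_mat N N"
    and "\<And>i j. i < N \<Longrightarrow> j < N \<Longrightarrow> i < j \<Longrightarrow> M $$ (i, j) = 0"
    and "r \<in> nonzero_vecs (N - 1)"
    and "\<And>i j. j \<le> i \<Longrightarrow> Suc i < N \<Longrightarrow>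
      M $$ (i, j) \<noteq> 0 \<and> M $$ (Suc i, j) / M $$ (i, j) = r $ i"
  shows "M \<in> L_CoLT N"
  using assms unfolding L_CoLT_def by blast

lemma U_CoLT_I:
  assumes "M \<in> carrier_mat N N"
    and "\<And>i j. i < N \<Longrightarrow> j < N \<Longrightarrow> i \<ge> j \<Longrightarrow> M $$ (i, j) = 0"
    and "r \<in> nonzero_vecs (N - 2)"
    and "\<And>k j. Suc k < j \<Longrightarrow> j < N \<Longrightarrow>
      M $$ (Suc k, j) \<noteq> 0 \<and> M $$ (k, j) / M $$ (Suc k, j) = r $ k"
  shows "M \<in> U_CoLT N"
  using assms unfolding U_CoLT_def by blast

lemma L_CoLT_E:
  assumes "M \<in> L_CoLT N"
  obtains r where "M \<in> carrier_mat N N" "r \<in> nonzero_vecs (N - 1)"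
    and "\<forall>i<N. \<forall>j<N. i < j \<longrightarrow> M $$ (i, j) = 0"
    and "\<forall>i j. j \<le> i \<and> Suc i < N \<longrightarrow>
      M $$ (i, j) \<noteq> 0 \<and> M $$ (Suc i, j) / M $$ (i, j) = r $ i"
  using assms unfolding L_CoLT_def mem_Collect_eq by (elim conjE bexE) (rule that)

lemma U_CoLT_E:
  assumes "M \<in> U_CoLT N"
  obtains r where "M \<in> carrier_mat N N" "r \<in> nonzero_vecs (N - 2)"
    and "\<forall>i<N. \<forall>j<N. i \<ge> j \<longrightarrow> M $$ (i, j) = 0"
    and "\<forall>k j. Suc k < j \<and> j < N \<longrightarrow>
      M $$ (Suc k, j) \<noteq> 0 \<and> M $$ (k, j) / M $$ (Suc k, j) = r $ k"
  using assms unfolding U_CoLT_def mem_Collect_eq by (elim conjE bexE) (rule that)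

text \<open>The factor that row scaling puts on the ratio of two consecutive rows depends on the
  rows alone, so one new ratio vector serves all columns.\<close>

lemma L_CoLT_diag_left:
  assumes x: "x \<in> nonzero_vecs N" and M: "M \<in> L_CoLT N"
  shows "diag_of_vec x * M \<in> L_CoLT N"
proof -
  from x have xc: "x \<in> carrier_vec N" and x0: "\<And>i. i < N \<Longrightarrow> x $ i \<noteq> 0"
    by (auto simp: nonzero_vecs_def)
  from M obtain r where Mc: "M \<in> carrier_mat N N"
    and r: "r \<in> nonzero_vecs (N - 1)"
    and tri: "\<forall>i<N. \<forall>j<N. i < j \<longrightarrow> M $$ (i, j) = 0"
    and ratios: "\<forall>i j. j \<le> i \<and> Suc i < N \<longrightarrow>
      M $$ (i, j) \<noteq> 0 \<and> M $$ (Suc i, j) / M $$ (i, j) = r $ i"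
    by (rule L_CoLT_E)
  note ratio = ratios[rule_format, OF conjI]
  \<comment> \<open>Row \<open>Suc i\<close> gains the factor \<open>x $ Suc i\<close> and row
    \<open>i\<close> the factor \<open>x $ i\<close>. For \<open>i < N - 1\<close> both indices lie
    below \<open>N\<close>, so both factors are nonzero.\<close>
  define s where "s = vec (N - 1) (\<lambda>i. x $ Suc i / x $ i * r $ i)"
  have s: "s \<in> nonzero_vecs (N - 1)"
    using r x0 by (auto simp: s_def nonzero_vecs_def)
  have scaled: "x $ i * M $$ (i, j) \<noteq> 0 \<and>
      x $ Suc i * M $$ (Suc i, j) / (x $ i * M $$ (i, j)) = s $ i"
    if "j \<le> i" "Suc i < N" for i j
  proof -
    \<comment> \<open>Since \<open>a / 0 = 0\<close>, this regrouping of a quotient of products is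
      unconditional; that the denominator is nonzero is settled at the end of the block.\<close>
    have "x $ Suc i * M $$ (Suc i, j) / (x $ i * M $$ (i, j)) =
        x $ Suc i / x $ i * (M $$ (Suc i, j) / M $$ (i, j))"
      by (rule times_divide_times_eq[symmetric])
    also have "\<dots> = s $ i"
      unfolding conjunct2[OF ratio[OF that]] using that by (simp add: s_def)
    finally show ?thesis
      using conjunct1[OF ratio[OF that]] x0[of i] that by simp
  qed
  show ?thesis
    unfolding diag_mult_left[OF xc Mc]
  proof (rule L_CoLT_I[OF _ _ s])
    let ?M = "mat N N (\<lambda>(i, j). x $ i * M $$ (i, j))"
    show "?M $$ (i, j) \<noteq> 0 \<and> ?M $$ (Suc i, j) / ?M $$ (i, j) = s $ i"
      if "j \<le> i" "Suc i < N" for i j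
      using scaled[OF that] that by (simp split: if_splits)
  \<comment> \<open>What remains is the dimension and the zero pattern: a zero entry stays zero when
    its row is scaled.\<close>
  qed (simp_all add: tri)
qed

text \<open>Both entries of a ratio lie in the same column \<open>j\<close>, so the common factor
  \<open>x $ j\<close> cancels and the old \<open>r\<close> still works.\<close>

lemma L_CoLT_diag_right:
  assumes x: "x \<in> nonzero_vecs N" and M: "M \<in> L_CoLT N"
  shows "M * diag_of_vec x \<in> L_CoLT N"
proof -
  from x have xc: "x \<in> carrier_vec N" and x0: "\<And>i. i < N \<Longrightarrow> x $ i \<noteq> 0"
    by (auto simp: nonzero_vecs_def)
  from M obtain r where Mc: "M \<in> carrier_mat N N"
    and r: "r \<in> nonzero_vecs (N - 1)"
    and tri: "\<forall>i<N. \<forall>j<N. i < j \<longrightarrow> M $$ (i, j) = 0"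
    and ratios: "\<forall>i j. j \<le> i \<and> Suc i < N \<longrightarrow>
      M $$ (i, j) \<noteq> 0 \<and> M $$ (Suc i, j) / M $$ (i, j) = r $ i"
    by (rule L_CoLT_E)
  note ratio = ratios[rule_format, OF conjI]
  have scaled: "M $$ (i, j) * x $ j \<noteq> 0 \<and>
      M $$ (Suc i, j) * x $ j / (M $$ (i, j) * x $ j) = r $ i"
    if "j \<le> i" "Suc i < N" for i j
    using ratio[OF that] x0[of j] that by simp
  show ?thesis
    unfolding diag_mult_right[OF xc Mc]
  proof (rule L_CoLT_I[OF _ _ r])
    let ?M = "mat N N (\<lambda>(i, j). M $$ (i, j) * x $ j)"
    show "?M $$ (i, j) \<noteq> 0 \<and> ?M $$ (Suc i, j) / ?M $$ (i, j) = r $ i"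
      if "j \<le> i" "Suc i < N" for i j
      using scaled[OF that] that by (simp split: if_splits)
  qed (simp_all add: tri)
qed

text \<open>Here ratios run upwards, row \<open>k\<close> over row \<open>Suc k\<close>, so the row
  factors enter inverted compared with the lower triangular case.\<close>

lemma U_CoLT_diag_left:
  assumes x: "x \<in> nonzero_vecs N" and M: "M \<in> U_CoLT N"
  shows "diag_of_vec x * M \<in> U_CoLT N"
proof -
  from x have xc: "x \<in> carrier_vec N" and x0: "\<And>i. i < N \<Longrightarrow> x $ i \<noteq> 0"
    by (auto simp: nonzero_vecs_def)
  from M obtain r where Mc: "M \<in> carrier_mat N N"
    and r: "r \<in> nonzero_vecs (N - 2)"
    and tri: "\<forall>i<N. \<forall>j<N. i \<ge> j \<longrightarrow> M $$ (i, j) = 0"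
    and ratios: "\<forall>k j. Suc k < j \<and> j < N \<longrightarrow>
      M $$ (Suc k, j) \<noteq> 0 \<and> M $$ (k, j) / M $$ (Suc k, j) = r $ k"
    by (rule U_CoLT_E)
  note ratio = ratios[rule_format, OF conjI]
  \<comment> \<open>From \<open>Suc k < j\<close> and \<open>j < N\<close> follows
    \<open>k < N - 2\<close>, so every ratio has its position in \<open>s\<close>. For
    \<open>N = 2\<close> there are no ratios and \<open>s\<close> is empty.\<close>
  define s where "s = vec (N - 2) (\<lambda>k. x $ k / x $ Suc k * r $ k)"
  have s: "s \<in> nonzero_vecs (N - 2)"
    using r x0 by (auto simp: s_def nonzero_vecs_def)
  have scaled: "x $ Suc k * M $$ (Suc k, j) \<noteq> 0 \<and>
      x $ k * M $$ (k, j) / (x $ Suc k * M $$ (Suc k, j)) = s $ k"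
    if "Suc k < j" "j < N" for k j
  proof -
    have "x $ k * M $$ (k, j) / (x $ Suc k * M $$ (Suc k, j)) =
        x $ k / x $ Suc k * (M $$ (k, j) / M $$ (Suc k, j))"
      by (rule times_divide_times_eq[symmetric])
    also have "\<dots> = s $ k"
      unfolding conjunct2[OF ratio[OF that]] using that by (simp add: s_def)
    finally show ?thesis
      using conjunct1[OF ratio[OF that]] x0[of "Suc k"] that by simp
  qed
  show ?thesis
    unfolding diag_mult_left[OF xc Mc]
  proof (rule U_CoLT_I[OF _ _ s])
    let ?M = "mat N N (\<lambda>(i, j). x $ i * M $$ (i, j))"
    show "?M $$ (Suc k, j) \<noteq> 0 \<and> ?M $$ (k, j) / ?M $$ (Suc k, j) = s $ k"
      if "Suc k < j" "j < N" for k j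
      using scaled[OF that] that by (simp split: if_splits)
  qed (simp_all add: tri)
qed

text \<open>Again the two entries compared share the column \<open>j\<close>, and the nonzero factor
  \<open>x $ j\<close> cancels.\<close>

lemma U_CoLT_diag_right:
  assumes x: "x \<in> nonzero_vecs N" and M: "M \<in> U_CoLT N"
  shows "M * diag_of_vec x \<in> U_CoLT N"
proof -
  from x have xc: "x \<in> carrier_vec N" and x0: "\<And>i. i < N \<Longrightarrow> x $ i \<noteq> 0"
    by (auto simp: nonzero_vecs_def)
  from M obtain r where Mc: "M \<in> carrier_mat N N"
    and r: "r \<in> nonzero_vecs (N - 2)"
    and tri: "\<forall>i<N. \<forall>j<N. i \<ge> j \<longrightarrow> M $$ (i, j) = 0"
    and ratios: "\<forall>k j. Suc k < j \<and> j < N \<longrightarrow>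
      M $$ (Suc k, j) \<noteq> 0 \<and> M $$ (k, j) / M $$ (Suc k, j) = r $ k"
    by (rule U_CoLT_E)
  note ratio = ratios[rule_format, OF conjI]
  have scaled: "M $$ (Suc k, j) * x $ j \<noteq> 0 \<and>
      M $$ (k, j) * x $ j / (M $$ (Suc k, j) * x $ j) = r $ k"
    if "Suc k < j" "j < N" for k j
    using ratio[OF that] x0[of j] that by simp
  show ?thesis
    unfolding diag_mult_right[OF xc Mc]
  proof (rule U_CoLT_I[OF _ _ r])
    let ?M = "mat N N (\<lambda>(i, j). M $$ (i, j) * x $ j)"
    show "?M $$ (Suc k, j) \<noteq> 0 \<and> ?M $$ (k, j) / ?M $$ (Suc k, j) = r $ k"
      if "Suc k < j" "j < N" for k j
      using scaled[OF that] that by (simp split: if_splits)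
  qed (simp_all add: tri)
qed

lemma CoLT_carrier: "M \<in> CoLT N \<Longrightarrow> M \<in> carrier_mat N N"
  by (auto simp: CoLT_def L_CoLT_def U_CoLT_def)

text \<open>Multiplication distributes over a decomposition \<open>A + B\<close>, and each summand
  stays in its own triangular class.\<close>

lemma CoLT_diag:
  assumes x: "x \<in> nonzero_vecs N" and M: "M \<in> CoLT N"
  shows "diag_of_vec x * M \<in> CoLT N" "M * diag_of_vec x \<in> CoLT N"
proof -
  from x have D: "diag_of_vec x \<in> carrier_mat N N"
    by (simp add: nonzero_vecs_def diag_of_vec_carrier)
  from M obtain A B where AB: "M = A + B" "A \<in> L_CoLT N" "B \<in> U_CoLT N"
    by (auto simp: CoLT_def)
  then have c: "A \<in> carrier_mat N N" "B \<in> carrier_mat N N"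
    by (auto simp: L_CoLT_def U_CoLT_def)
  have "diag_of_vec x * M = diag_of_vec x * A + diag_of_vec x * B"
    unfolding AB(1) by (rule mult_add_distrib_mat[OF D c])
  then show "diag_of_vec x * M \<in> CoLT N"
    using L_CoLT_diag_left[OF x AB(2)] U_CoLT_diag_left[OF x AB(3)]
    by (auto simp: CoLT_def)
  have "M * diag_of_vec x = A * diag_of_vec x + B * diag_of_vec x"
    unfolding AB(1) by (rule add_mult_distrib_mat[OF c D])
  then show "M * diag_of_vec x \<in> CoLT N"
    using L_CoLT_diag_right[OF x AB(2)] U_CoLT_diag_right[OF x AB(3)]
    by (auto simp: CoLT_def)
qed

lemma diag_of_vec_inverse:
  assumes "x \<in> nonzero_vecs N"
  shows "diag_of_vec (map_vec inverse x) * diag_of_vec x = 1\<^sub>m N"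
    and "diag_of_vec x * diag_of_vec (map_vec inverse x) = 1\<^sub>m N"
proof -
  from assms have "dim_vec x = N" and "\<And>i. i < N \<Longrightarrow> x $ i \<noteq> 0"
    by (auto simp: nonzero_vecs_def)
  then show "diag_of_vec (map_vec inverse x) * diag_of_vec x = 1\<^sub>m N"
    and "diag_of_vec x * diag_of_vec (map_vec inverse x) = 1\<^sub>m N"
    \<comment> \<open>The cancellation \<open>inverse (x $ i) * x $ i = 1\<close> is known only for
      \<open>i < N\<close>, so in the end \<open>mat_diag\<close> is unfolded and the entries are
      compared within bounds.\<close>
    by (auto simp: diag_of_vec_def) (auto simp: mat_diag_def)
qed

theorem corollary3p7:
  fixes N :: nat and x :: "real vec"
  assumes "N \<ge> 2" and "x \<in> nonzero_vecs N"
  shows "bij_betw (\<lambda>M. diag_of_vec x * M) (CoLT N) (CoLT N) \<and>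
         bij_betw (\<lambda>M. M * diag_of_vec x) (CoLT N) (CoLT N)"
proof -
  \<comment> \<open>The reciprocals are again nonzero, so \<open>CoLT_diag\<close> also applies to
    \<open>y\<close>: the candidate inverse maps send \<open>CoLT N\<close> into itself.\<close>
  define y where "y = map_vec inverse x"
  have y: "y \<in> nonzero_vecs N"
    using assms(2) by (auto simp: y_def nonzero_vecs_def)
  have D: "diag_of_vec x \<in> carrier_mat N N" "diag_of_vec y \<in> carrier_mat N N"
    using assms(2) y by (auto simp: nonzero_vecs_def diag_of_vec_carrier)
  note inv = diag_of_vec_inverse[OF assms(2), folded y_def]
  \<comment> \<open>Reassociating brings the two diagonal matrices together, where they multiply to
    the identity. Associativity requires matching dimensions, which membership in
    \<open>CoLT N\<close> provides.\<close>
  have left: "diag_of_vec y * (diag_of_vec x * M) = M" "diag_of_vec x * (diag_of_vec y * M) = M"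
    and right: "M * diag_of_vec x * diag_of_vec y = M" "M * diag_of_vec y * diag_of_vec x = M"
    if "M \<in> CoLT N" for M
  proof -
    note M = CoLT_carrier[OF that]
    note assoc = assoc_mult_mat[OF D(1) D(2) M] assoc_mult_mat[OF D(2) D(1) M]
      assoc_mult_mat[OF M D(1) D(2)] assoc_mult_mat[OF M D(2) D(1)]
    show "diag_of_vec y * (diag_of_vec x * M) = M" "diag_of_vec x * (diag_of_vec y * M) = M"
      "M * diag_of_vec x * diag_of_vec y = M" "M * diag_of_vec y * diag_of_vec x = M"
      using assoc M by (simp_all add: inv)
  qed
  have "bij_betw (\<lambda>M. diag_of_vec x * M) (CoLT N) (CoLT N)"
    \<comment> \<open>The witness needs cancellation in both orders and both inclusions;
      surjectivity rests on scaling by \<open>y\<close> preserving \<open>CoLT N\<close>.\<close>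
    by (rule bij_betw_byWitness[where f' = "\<lambda>M. diag_of_vec y * M"])
      (auto simp: left CoLT_diag assms(2) y)
  moreover have "bij_betw (\<lambda>M. M * diag_of_vec x) (CoLT N) (CoLT N)"
    by (rule bij_betw_byWitness[where f' = "\<lambda>M. M * diag_of_vec y"])
      (auto simp: right CoLT_diag assms(2) y)
  ultimately show ?thesis ..
qed

end
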